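(* Let $d$ be a prime and let $t,w$ be integers. Let $\mathcal{L}_d(x,y,z)=\mathbb{F}_d[x^{\pm1},y^{\pm1},z^{\pm1}]$ and let $U=P+QA+RB+SC\in \mathbf{M}_4(\mathcal{L}_d(x,y,z))$ be the matrix attached to the parameters $d,t,w$ as defined in the context, with inverse $U'=U^{-1}\in\mathbf{M}_4(\mathcal{L}_d(x,y,z))$. Then $\det U=\det U'=1$.
   Context: $\mathbb{F}_d=\mathrm{GF}(d)$ is the field with $d$ elements, $d$ prime; $\mathcal{L}_d(x,y,z)$ is the Laurent polynomial ring in the commuting variables $x,y,z$ over $\mathbb{F}_d$. All matrices are $4\times4$ over $\mathcal{L}_d(x,y,z)$ and $I$ is the identity matrix. Define \[ A=\begin{pmatrix} 0&1&0&0 \\ x&0&0&0 \\ 0&0&0&x^{-1} y z^{-1} \\ 0&0& y^{-1} z&0 \end{pmatrix},\qquad B=\begin{pmatrix} 0&0&1&0 \\ 0&0&0&1 \\ y&0&0&0 \\ 0&y^{-1} &0&0 \end{pmatrix},\qquad C=AB=\begin{pmatrix} 0&0&0&1 \\ 0&0&x&0 \\ 0&x^{-1} z^{-1}&0&0 \\ z&0&0&0 \end{pmatrix},\] \[ X=A^2=\mathrm{diag}(x,x,x^{-1},x^{-1}),\quad Y=B^2=\mathrm{diag}(y,y^{-1},y,y^{-1}),\quad Z=C^2=\mathrm{diag}(z,z^{-1},z^{-1},z).\] For a prime $d$ and integers $t,w$ define the diagonal matrices \[ H=(I-Z^{1-2t})^{d-2},\] \[ P=(I+X)(I+Y)(Z^t+Z^{1-t})H,\]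 \[ Q=Z^w[(I+X)(X^{-1}+Y^{-1})+(I+Y^{-1})(I+Z^{2t-1})]H,\] \[ R=Z^w[(I+Y^{-1})(X+Y)Z^t+(I+X)(Z^t+Z^{1-t})]H,\] \[ S=Z^{2t-1}+(4I+X+X^{-1}+Y+Y^{-1})H\] (for $d=2$, $H=I$), and set $U=P+QA+RB+SC$. Background: let $\mathfrak{G}=\langle a,b\mid (a^2)^b=a^{-2},\,(b^2)^a=b^{-2}\rangle$, where $g^k=k^{-1}gk$, let $c=ab$, and let $\mathfrak{H}$ be the normal free abelian subgroup of index 4 on $x=a^2,\ y=b^2,\ z=c^2$. The group algebra $\mathbb{F}_d[\mathfrak{G}]$ embeds in $\mathbf{M}_4(\mathbb{F}_d[\mathfrak{H}])=\mathbf{M}_4(\mathcal{L}_d(x,y,z))$ through its right multiplication action on $\mathbb{F}_d[\mathfrak{G}]$, viewed as a free left $\mathbb{F}_d[\mathfrak{H}]$-module with basis $1,a,b,c$; the matrices of $a,b,c,x,y,z$ are $A,B,C,X,Y,Z$. It is a known result of Murray that for all primes $d$ and integers $t,w$, the matrix $U$ is the image of a nontrivial unit of $\mathbb{F}_d[\mathfrak{G}]$ (a unit that is not a scalar multiple of an element of $\mathfrak{G}$); in particular $U$ is invertible in $\mathbf{M}_4(\mathcal{L}_d(x,y,z))$, and $U'$ denotes its inverse, which is the image of the inverse unit. *)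

theory Defs
  imports "HOL-Analysis.Determinants" "HOL-Library.Poly_Mapping"
    "HOL-Computational_Algebra.Primes"
begin

text \<open>
  The Laurent polynomial ring in three commuting variables is the group algebra of the free
  abelian group of exponent vectors (i, j, k): finitely supported coefficient functions with the
  convolution product of \<^theory>\<open>HOL-Library.Poly_Mapping\<close>.
\<close>

type_synonym 'k laurent3 = "(int \<times> int \<times> int) \<Rightarrow>\<^sub>0 'k"

text \<open>The monomial x^i y^j z^k.\<close>

definition xyz :: "int \<Rightarrow> int \<Rightarrow> int \<Rightarrow> 'k::comm_ring_1 laurent3" where
  "xyz i j k = Poly_Mapping.single (i, j, k) 1"

lemma xyz_mult: "xyz i j k * xyz i' j' k' = xyz (i + i') (j + j') (k + k')"
  by (simp add: xyz_def mult_single)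

lemma xyz_0: "xyz 0 0 0 = 1"
  by (simp add: xyz_def flip: zero_prod_def)

lemma vector_4 [simp]:
  "(vector [a, b, c, e] :: 'a::zero^4) $ 1 = a"
  "(vector [a, b, c, e] :: 'a^4) $ 2 = b"
  "(vector [a, b, c, e] :: 'a^4) $ 3 = c"
  "(vector [a, b, c, e] :: 'a^4) $ 4 = e"
  unfolding vector_def by simp_all

text \<open>
  On \<^typ>\<open>'a^'n^'n\<close> the class operations for product, power and one are entrywise. Matrix products
  below are therefore written with \<^term>\<open>(**)\<close>, the identity is \<^term>\<open>mat 1\<close>, and matrix powers
  are defined separately. Negative exponents refer to \<^const>\<open>matrix_inv\<close>, so they are
  meaningful for invertible matrices only.
\<close>

primrec mat_pow :: "'a::semiring_1^'n^'n \<Rightarrow> nat \<Rightarrow> 'a^'n^'n" where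
  "mat_pow M 0 = mat 1"
| "mat_pow M (Suc n) = M ** mat_pow M n"

definition mat_powi :: "'a::semiring_1^'n^'n \<Rightarrow> int \<Rightarrow> 'a^'n^'n" where
  "mat_powi M k =
     (if k \<ge> 0 then mat_pow M (nat k) else mat_pow (matrix_inv M) (nat (- k)))"

definition matA :: "'k::comm_ring_1 laurent3^4^4" where
  "matA = vector
    [vector [0,         1, 0,            0],
     vector [xyz 1 0 0, 0, 0,            0],
     vector [0,         0, 0,            xyz (-1) 1 (-1)],
     vector [0,         0, xyz 0 (-1) 1, 0]]"

definition matB :: "'k::comm_ring_1 laurent3^4^4" where
  "matB = vector
    [vector [0,         0,            1, 0],
     vector [0,         0,            0, 1],
     vector [xyz 0 1 0, 0,            0, 0],
     vector [0,         xyz 0 (-1) 0, 0, 0]]"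

definition matC :: "'k::comm_ring_1 laurent3^4^4" where
  "matC = matA ** matB"

definition matX :: "'k::comm_ring_1 laurent3^4^4" where
  "matX = matA ** matA"

definition matY :: "'k::comm_ring_1 laurent3^4^4" where
  "matY = matB ** matB"

definition matZ :: "'k::comm_ring_1 laurent3^4^4" where
  "matZ = matC ** matC"

text \<open>The truncated exponent \<^term>\<open>d - 2\<close> is only used for a prime d, hence at least 2.\<close>

definition matH :: "nat \<Rightarrow> int \<Rightarrow> 'k::comm_ring_1 laurent3^4^4" where
  "matH d t = mat_pow (mat 1 - mat_powi matZ (1 - 2 * t)) (d - 2)"

definition matP :: "nat \<Rightarrow> int \<Rightarrow> 'k::comm_ring_1 laurent3^4^4" where
  "matP d t = (mat 1 + matX) ** (mat 1 + matY) **
     (mat_powi matZ t + mat_powi matZ (1 - t)) ** matH d t"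

definition matQ :: "nat \<Rightarrow> int \<Rightarrow> int \<Rightarrow> 'k::comm_ring_1 laurent3^4^4" where
  "matQ d t w = mat_powi matZ w **
     ((mat 1 + matX) ** (matrix_inv matX + matrix_inv matY)
      + (mat 1 + matrix_inv matY) ** (mat 1 + mat_powi matZ (2 * t - 1))) ** matH d t"

definition matR :: "nat \<Rightarrow> int \<Rightarrow> int \<Rightarrow> 'k::comm_ring_1 laurent3^4^4" where
  "matR d t w = mat_powi matZ w **
     ((mat 1 + matrix_inv matY) ** (matX + matY) ** mat_powi matZ t
      + (mat 1 + matX) ** (mat_powi matZ t + mat_powi matZ (1 - t))) ** matH d t"

definition matS :: "nat \<Rightarrow> int \<Rightarrow> 'k::comm_ring_1 laurent3^4^4" where
  "matS d t = mat_powi matZ (2 * t - 1)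
     + (mat 4 + matX + matrix_inv matX + matY + matrix_inv matY) ** matH d t"

definition matU :: "nat \<Rightarrow> int \<Rightarrow> int \<Rightarrow> 'k::comm_ring_1 laurent3^4^4" where
  "matU d t w = matP d t + matQ d t w ** matA + matR d t w ** matB + matS d t ** matC"

text \<open>The explicit forms of the derived matrices, and invertibility of the three diagonal ones.\<close>

definition diag4 :: "'a::zero \<Rightarrow> 'a \<Rightarrow> 'a \<Rightarrow> 'a \<Rightarrow> 'a^4^4" where
  "diag4 a b c e =
     vector [vector [a, 0, 0, 0], vector [0, b, 0, 0], vector [0, 0, c, 0], vector [0, 0, 0, e]]"

lemma matC_eq: "matC = vector
    [vector [0,         0,               0,         1],
     vector [0,         0,               xyz 1 0 0, 0],
     vector [0,         xyz (-1) 0 (-1), 0,         0],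
     vector [xyz 0 0 1, 0,               0,         0]]"
  unfolding matC_def matA_def matB_def
  by (simp add: vec_eq_iff forall_4 matrix_matrix_mult_def sum_4 xyz_mult)

lemma matX_eq: "matX = diag4 (xyz 1 0 0) (xyz 1 0 0) (xyz (-1) 0 0) (xyz (-1) 0 0)"
  unfolding matX_def matA_def diag4_def
  by (simp add: vec_eq_iff forall_4 matrix_matrix_mult_def sum_4 xyz_mult)

lemma matY_eq: "matY = diag4 (xyz 0 1 0) (xyz 0 (-1) 0) (xyz 0 1 0) (xyz 0 (-1) 0)"
  unfolding matY_def matB_def diag4_def
  by (simp add: vec_eq_iff forall_4 matrix_matrix_mult_def sum_4 xyz_mult)

lemma matZ_eq: "matZ = diag4 (xyz 0 0 1) (xyz 0 0 (-1)) (xyz 0 0 (-1)) (xyz 0 0 1)"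
  unfolding matZ_def matC_eq diag4_def
  by (simp add: vec_eq_iff forall_4 matrix_matrix_mult_def sum_4 xyz_mult)

lemma diag4_mult:
  "diag4 a b c e ** diag4 a' b' c' e' = diag4 (a * a') (b * b') (c * c') (e * e' :: 'a::semiring_1)"
  unfolding diag4_def
  by (simp add: vec_eq_iff forall_4 matrix_matrix_mult_def sum_4)

lemma mat_eq_diag4: "mat a = diag4 a a a a"
  unfolding diag4_def by (simp add: vec_eq_iff forall_4 mat_def)

lemma invertible_XYZ:
  "invertible (matX :: 'k::comm_ring_1 laurent3^4^4)"
  "invertible (matY :: 'k laurent3^4^4)"
  "invertible (matZ :: 'k laurent3^4^4)"
proof -
  let ?X = "diag4 (xyz (-1) 0 0) (xyz (-1) 0 0) (xyz 1 0 0) (xyz 1 0 0) :: 'k laurent3^4^4"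
  let ?Y = "diag4 (xyz 0 (-1) 0) (xyz 0 1 0) (xyz 0 (-1) 0) (xyz 0 1 0) :: 'k laurent3^4^4"
  let ?Z = "diag4 (xyz 0 0 (-1)) (xyz 0 0 1) (xyz 0 0 1) (xyz 0 0 (-1)) :: 'k laurent3^4^4"
  have "matX ** ?X = mat 1" "?X ** matX = mat 1" "matY ** ?Y = mat 1" "?Y ** matY = mat 1"
    "matZ ** ?Z = mat 1" "?Z ** matZ = mat 1"
    by (simp_all add: matX_eq matY_eq matZ_eq mat_eq_diag4 diag4_mult xyz_mult xyz_0)
  then show "invertible (matX :: 'k laurent3^4^4)" "invertible (matY :: 'k laurent3^4^4)"
    "invertible (matZ :: 'k laurent3^4^4)"
    unfolding invertible_def by blast+
qed

end

theory Submission
  imports Defs "HOL-Library.Product_Lexorder"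
begin

text \<open>
  Put \<open>p = z^t\<close>, \<open>q = z^(1 - t)\<close> and let \<open>h\<close>, \<open>k\<close> be the two distinct diagonal entries of \<open>H\<close>.
  After rescaling rows and columns by monomials, \<open>U\<close> becomes a polynomial matrix in
  \<open>x\<close>, \<open>y\<close>, \<open>p\<close>, \<open>q\<close>, \<open>a = h q / p\<close> and \<open>b = k p / q\<close>, and for indeterminate \<open>a\<close> and \<open>b\<close>
  the determinant is
  \<open>(1 + s r)^2 - (1 + x)^2 (1 + y)^2 (p + q)^2 r^2 / (x y p q)\<close>, where
  \<open>s = 4 + x + 1/x + y + 1/y\<close> and \<open>r = a + b - (p - q)^2 a b / (p q)\<close>. The characteristic
  enters only through \<open>r = 0\<close>, which follows from \<open>(1 - v)^d = 1 - v^d\<close> for \<open>v = p / q\<close>.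
\<close>

section \<open>Determinants and inverses over commutative rings\<close>

text \<open>Laplace expansion along rows 1 and 4, with complementary minors from rows 2 and 3. In
  \<open>U\<close> these pairs of rows carry \<open>h\<close> and \<open>k\<close> respectively, so
  the grouping keeps the two apart.\<close>

lemma det_4:
  "det (A :: 'a::comm_ring_1^4^4) =
      (A$1$1 * A$4$4 - A$1$4 * A$4$1) * (A$2$2 * A$3$3 - A$2$3 * A$3$2)
    - (A$1$1 * A$4$2 - A$1$2 * A$4$1) * (A$2$4 * A$3$3 - A$2$3 * A$3$4)
    - (A$1$1 * A$4$3 - A$1$3 * A$4$1) * (A$2$2 * A$3$4 - A$2$4 * A$3$2)
    + (A$1$2 * A$4$3 - A$1$3 * A$4$2) * (A$2$1 * A$3$4 - A$2$4 * A$3$1)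
    - (A$1$2 * A$4$4 - A$1$4 * A$4$2) * (A$2$1 * A$3$3 - A$2$3 * A$3$1)
    + (A$1$3 * A$4$4 - A$1$4 * A$4$3) * (A$2$1 * A$3$2 - A$2$2 * A$3$1)"
proof -
  have f1234: "finite {2::4, 3, 4}" "1 \<notin> {2::4, 3, 4}" by auto
  have f234: "finite {3::4, 4}" "2 \<notin> {3::4, 4}" by auto
  have f34: "finite {4::4}" "3 \<notin> {4::4}" by auto
  show ?thesis
    unfolding det_def UNIV_4
    unfolding sum_over_permutations_insert[OF f1234]
    unfolding sum_over_permutations_insert[OF f234]
    unfolding sum_over_permutations_insert[OF f34]
    unfolding permutes_sing
    by (simp add: sign_swap_id permutation_swap_id permutation_compose sign_compose sign_id
        swap_id_eq)
      (simp add: algebra_simps)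
qed

text \<open>Putting a unit vector into a row yields the signed cofactor directly, without
  submatrices over a smaller index type.\<close>

definition adjugate :: "'a::comm_ring_1^'n^'n \<Rightarrow> 'a^'n^'n" where
  "adjugate A = (\<chi> j i. det (\<chi> k. if k = i then axis j 1 else A $ k))"

lemma det_replace_row:
  fixes A :: "'a::comm_ring_1^'n^'n"
  shows "det (\<chi> k. if k = i then A $ l else A $ k) = (if l = i then det A else 0)"
proof (cases "l = i")
  case True
  then have "(\<chi> k. if k = i then A $ l else A $ k) = A"
    by (simp add: vec_eq_iff)
  with True show ?thesis
    by simp
next
  case False
  then have "det (\<chi> k. if k = i then A $ l else A $ k) = 0"
    by (intro det_identical_rows[of i l]) (simp_all add: row_def)
  with False show ?thesis
    by simp
qed

text \<open>Expanding row \<open>l\<close> in unit vectors and using linearity of \<open>det\<close>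
  in row \<open>i\<close> leaves the determinant of \<open>A\<close> with row \<open>i\<close>
  overwritten by row \<open>l\<close>.\<close>

lemma matrix_mult_adjugate:
  fixes A :: "'a::comm_ring_1^'n^'n"
  shows "A ** adjugate A = mat (det A)"
proof -
  have "(\<Sum>j\<in>UNIV. A $ l $ j * det (\<chi> k. if k = i then axis j 1 else A $ k))
      = (if l = i then det A else 0)" for l i
  proof -
    have "(\<Sum>j\<in>UNIV. A $ l $ j * det (\<chi> k. if k = i then axis j 1 else A $ k))
        = (\<Sum>j\<in>UNIV. det (\<chi> k. if k = i then A $ l $ j *s axis j 1 else A $ k))"
      by (simp add: det_row_mul[where a = "\<lambda>_. axis _ 1"])
    also have "\<dots> = det (\<chi> k. if k = i then (\<Sum>j\<in>UNIV. A $ l $ j *s axis j 1) else A $ k)"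
      by (rule det_linear_row_sum[where a = "\<lambda>_ j. A $ l $ j *s axis j 1", symmetric]) simp
    also have "(\<Sum>j\<in>UNIV. A $ l $ j *s axis j 1) = A $ l"
      by (rule basis_expansion)
    finally show ?thesis
      by (simp add: det_replace_row)
  qed
  then show ?thesis
    by (simp add: vec_eq_iff matrix_matrix_mult_def adjugate_def mat_def)
qed

lemma matrix_inv_inverse:
  assumes "invertible A"
  shows "A ** matrix_inv A = mat 1" "matrix_inv A ** A = mat 1"
  using someI_ex[OF assms[unfolded invertible_def]] unfolding matrix_inv_def by auto

text \<open>The adjugate gives a right inverse and, via the transpose, a left one; associativity
  makes them agree.\<close>

lemma invertible_if_det_eq_1:
  fixes A :: "'a::comm_ring_1^'n^'n"
  assumes "det A = 1"
  shows "invertible A"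
proof -
  let ?L = "transpose (adjugate (transpose A))"
  have right: "A ** adjugate A = mat 1"
    using assms by (simp add: matrix_mult_adjugate)
  have "transpose (transpose A ** adjugate (transpose A)) = mat 1"
    using assms by (simp add: matrix_mult_adjugate)
  then have left: "?L ** A = mat 1"
    by (simp add: matrix_transpose_mul)
  have "?L = ?L ** (A ** adjugate A)"
    by (simp add: right)
  also have "\<dots> = adjugate A"
    by (simp add: matrix_mul_assoc left)
  finally have "?L = adjugate A" .
  with left right show ?thesis
    unfolding invertible_def by metis
qed

lemma det_matrix_inv_if_det_eq_1:
  fixes A :: "'a::comm_ring_1^'n^'n"
  assumes "det A = 1"
  shows "det (matrix_inv A) = 1"
proof -
  have "A ** matrix_inv A = mat 1"
    using invertible_if_det_eq_1[OF assms] by (rule matrix_inv_inverse(1))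
  then have "det A * det (matrix_inv A) = 1"
    by (metis det_mul det_I)
  then show ?thesis
    by (simp add: assms)
qed

lemma matrix_inv_eqI:
  fixes A :: "'a::semiring_1^'n^'n"
  assumes "A ** B = mat 1" and "B ** A = mat 1"
  shows "matrix_inv A = B"
proof -
  have "invertible A"
    using assms unfolding invertible_def by blast
  then have "B ** (A ** matrix_inv A) = B"
    by (simp add: matrix_inv_inverse)
  then show ?thesis
    by (simp add: matrix_mul_assoc assms)
qed

section \<open>Diagonal matrices\<close>

lemma diag4_add:
  "diag4 a b c e + diag4 a' b' c' e' = diag4 (a + a') (b + b') (c + c') (e + e' :: 'a::semiring_1)"
  unfolding diag4_def by (simp add: vec_eq_iff forall_4)

lemma diag4_diff:
  "diag4 a b c e - diag4 a' b' c' e' = diag4 (a - a') (b - b') (c - c') (e - e' :: 'a::ring_1)"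
  unfolding diag4_def by (simp add: vec_eq_iff forall_4)

lemma mat_pow_diag4:
  "mat_pow (diag4 a b c e) n = diag4 (a ^ n) (b ^ n) (c ^ n) (e ^ n :: 'a::semiring_1)"
  by (induction n) (simp_all add: mat_eq_diag4 diag4_mult)

lemma matrix_inv_diag4:
  fixes a :: "'a::comm_semiring_1"
  assumes "a * a' = 1" "b * b' = 1" "c * c' = 1" "e * e' = 1"
  shows "matrix_inv (diag4 a b c e) = diag4 a' b' c' e'"
  by (rule matrix_inv_eqI) (simp_all add: diag4_mult mat_eq_diag4 assms mult.commute[of _ a]
      mult.commute[of _ b] mult.commute[of _ c] mult.commute[of _ e])

lemma det_diag4: "det (diag4 a b c e) = a * b * c * (e :: 'a::comm_ring_1)"
  unfolding det_4 diag4_def by simp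

lemma diag4_scale:
  "diag4 a b c (e :: 'a::comm_semiring_1) ** vector
       [vector [m11, m12, m13, m14],
        vector [m21, m22, m23, m24],
        vector [m31, m32, m33, m34],
        vector [m41, m42, m43, m44]]
      ** diag4 a' b' c' e' = vector
       [vector [a * m11 * a', a * m12 * b', a * m13 * c', a * m14 * e'],
        vector [b * m21 * a', b * m22 * b', b * m23 * c', b * m24 * e'],
        vector [c * m31 * a', c * m32 * b', c * m33 * c', c * m34 * e'],
        vector [e * m41 * a', e * m42 * b', e * m43 * c', e * m44 * e']]"
  unfolding diag4_def by (simp add: vec_eq_iff forall_4 matrix_matrix_mult_def sum_4)

text \<open>Applied to rows and then to entries, this splits a matrix equation into sixteen scalar
  ones.\<close>

lemma vector_4_cong:
  "\<lbrakk>a = a'; b = b'; c = c'; e = e'\<rbrakk> \<Longrightarrow> vector [a, b, c, e] = vector [a', b', c', e']"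
  by simp

lemma xyz_power: "xyz i j k ^ n = xyz (int n * i) (int n * j) (int n * k)"
  by (induction n) (simp_all add: xyz_0 xyz_mult algebra_simps)

lemma matrix_inv_matX:
  "matrix_inv matX = diag4 (xyz (-1) 0 0) (xyz (-1) 0 0) (xyz 1 0 0) (xyz 1 0 0)"
  unfolding matX_eq by (rule matrix_inv_diag4) (simp_all add: xyz_mult xyz_0)

lemma matrix_inv_matY:
  "matrix_inv matY = diag4 (xyz 0 (-1) 0) (xyz 0 1 0) (xyz 0 (-1) 0) (xyz 0 1 0)"
  unfolding matY_eq by (rule matrix_inv_diag4) (simp_all add: xyz_mult xyz_0)

lemma matrix_inv_matZ:
  "matrix_inv matZ = diag4 (xyz 0 0 (-1)) (xyz 0 0 1) (xyz 0 0 1) (xyz 0 0 (-1))"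
  unfolding matZ_eq by (rule matrix_inv_diag4) (simp_all add: xyz_mult xyz_0)

lemma mat_powi_matZ:
  "mat_powi matZ m = diag4 (xyz 0 0 m) (xyz 0 0 (-m)) (xyz 0 0 (-m)) (xyz 0 0 m)"
  unfolding mat_powi_def matrix_inv_matZ by (simp add: matZ_eq mat_pow_diag4 xyz_power)

lemma matH_eq:
  "matH d t = diag4 ((1 - xyz 0 0 (1 - 2 * t)) ^ (d - 2)) ((1 - xyz 0 0 (2 * t - 1)) ^ (d - 2))
     ((1 - xyz 0 0 (2 * t - 1)) ^ (d - 2)) ((1 - xyz 0 0 (1 - 2 * t)) ^ (d - 2))"
  by (simp add: matH_def mat_powi_matZ mat_eq_diag4 diag4_diff mat_pow_diag4)

text \<open>The supports of a diagonal matrix, \<open>matA\<close>, \<open>matB\<close> and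
  \<open>matC\<close> partition the sixteen positions, so each entry comes from one summand
  only.\<close>

lemma diag4_combination:
  "diag4 p1 p2 p3 p4 + diag4 q1 q2 q3 q4 ** matA + diag4 r1 r2 r3 r4 ** matB
      + diag4 s1 s2 s3 s4 ** matC
    = (vector
       [vector [p1, q1, r1, s1],
        vector [q2 * xyz 1 0 0, p2, s2 * xyz 1 0 0, r2],
        vector [r3 * xyz 0 1 0, s3 * xyz (-1) 0 (-1), p3, q3 * xyz (-1) 1 (-1)],
        vector [s4 * xyz 0 0 1, r4 * xyz 0 (-1) 0, q4 * xyz 0 (-1) 1, p4]]
       :: 'k::comm_ring_1 laurent3^4^4)"
  unfolding diag4_def matA_def matB_def matC_eq
  by (simp add: vec_eq_iff forall_4 matrix_matrix_mult_def sum_4)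

section \<open>The determinant\<close>

text \<open>
  With the lexicographic order on exponent vectors, Laurent polynomials over a field become an
  instance of \<^class>\<open>idom\<close>.
\<close>

instance prod :: (ordered_cancel_comm_monoid_add, ordered_cancel_comm_monoid_add)
  ordered_cancel_comm_monoid_add
  by standard (auto simp: less_eq_prod_def less_le add_left_mono)

text \<open>Here \<open>s\<close> and \<open>r\<close> are the quantities of the introduction times
  \<open>x * y\<close> and \<open>p * q\<close>. Swapping \<open>p\<close> and \<open>q\<close> and
  inverting \<open>y\<close> in \<open>E\<close> (or \<open>x\<close> in \<open>F\<close>) gives
  \<open>E'\<close> (or \<open>F'\<close>) up to the factor clearing denominators.\<close>

lemma det_polynomial_form:
  fixes x y p q a b :: "'a::idom"
  defines "G \<equiv> (1 + x) * (1 + y) * (p + q)"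
    and "E \<equiv> (1 + x) * (x + y) * q + x * (1 + y) * (p + q)"
    and "F \<equiv> (1 + y) * (x + y) * p + (1 + x) * y * (p + q)"
    and "E' \<equiv> (1 + x) * (1 + x * y) * p + x * (1 + y) * (p + q)"
    and "F' \<equiv> (1 + y) * (1 + x * y) * q + (1 + x) * y * (p + q)"
    and "s \<equiv> x * x * y + y + x * y * y + x + 4 * x * y"
    and "r \<equiv> p * q * (a + b) - (p - q)^2 * a * b"
  shows "det (vector
      [vector [x * y * q * G * a, E * a, x * q * F * a, q * (x * y + s * a)],
       vector [y * q * E' * b, G * b, p * q * (x * y + s * b), F' * b],
       vector [x * y * p * F' * b, p * (x * y + s * b), x * y * p * G * b, y * E' * b],
       vector [y * p * q * (x * y + s * a), F * a, y * p * E * a, y * G * a]] :: 'a^4^4)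
    = x^2 * y^3 * (p * q * (x * y * p * q + s * r)^2 - x * y * G^2 * r^2)"
  unfolding det_4 vector_4 assms by algebra

text \<open>Inverses are separate arguments of the four coefficients: the diagonal entries of
  \<open>P\<close>, \<open>Q\<close>, \<open>R\<close>, \<open>S\<close> then differ only by
  exchanging variables with their inverses and \<open>h\<close> with \<open>k\<close>.\<close>

definition coefP :: "'a::comm_ring_1 \<Rightarrow> 'a \<Rightarrow> 'a \<Rightarrow> 'a \<Rightarrow> 'a \<Rightarrow> 'a" where
  "coefP x y p q h = (1 + x) * (1 + y) * (p + q) * h"

definition coefQ :: "'a::comm_ring_1 \<Rightarrow> 'a \<Rightarrow> 'a \<Rightarrow> 'a \<Rightarrow> 'a \<Rightarrow> 'a \<Rightarrow> 'a" where
  "coefQ w x x' y' v h = w * ((1 + x) * (x' + y') + (1 + y') * (1 + v)) * h"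

definition coefR :: "'a::comm_ring_1 \<Rightarrow> 'a \<Rightarrow> 'a \<Rightarrow> 'a \<Rightarrow> 'a \<Rightarrow> 'a \<Rightarrow> 'a \<Rightarrow> 'a" where
  "coefR w x y y' p q h = w * ((1 + y') * (x + y) * p + (1 + x) * (p + q)) * h"

definition coefS :: "'a::comm_ring_1 \<Rightarrow> 'a \<Rightarrow> 'a \<Rightarrow> 'a \<Rightarrow> 'a \<Rightarrow> 'a \<Rightarrow> 'a" where
  "coefS x x' y y' v h = v + (4 + x + x' + y + y') * h"

text \<open>Writing \<open>z\<close> as \<open>p * q\<close> makes \<open>p\<close> and
  \<open>q\<close> independent units; \<open>hk\<close> is the equation
  \<open>r = 0\<close>.\<close>

lemma det_unit_form:
  fixes x y p q w h k :: "'a::idom"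
  assumes x: "x * x' = 1" and y: "y * y' = 1" and p: "p * p' = 1" and q: "q * q' = 1"
    and w: "w * w' = 1"
    and hk: "q^2 * h + p^2 * k = (p - q)^2 * h * k"
  shows "det (vector
      [vector [coefP x y p q h, coefQ w x x' y' (p * q') h, coefR w x y y' p q h,
         coefS x x' y y' (p * q') h],
       vector [x * coefQ w' x x' y (p' * q) k, coefP x y' p' q' k, x * coefS x x' y' y (p' * q) k,
         coefR w' x y' y p' q' k],
       vector [y * coefR w' x' y y' p' q' k, x' * p' * q' * coefS x' x y y' (p' * q) k,
         coefP x' y p' q' k, x' * y * p' * q' * coefQ w' x' x y' (p' * q) k],
       vector [p * q * coefS x' x y' y (p * q') h, y' * coefR w x' y' y p q h,
         y' * p * q * coefQ w x' x y (p * q') h, coefP x' y' p q h]] :: 'a^4^4) = 1"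
    (is "det ?M = 1")
proof -
  define a where "a = h * q * p'"
  define b where "b = k * p * q'"
  define G where "G = (1 + x) * (1 + y) * (p + q)"
  define E where "E = (1 + x) * (x + y) * q + x * (1 + y) * (p + q)"
  define F where "F = (1 + y) * (x + y) * p + (1 + x) * y * (p + q)"
  define E' where "E' = (1 + x) * (1 + x * y) * p + x * (1 + y) * (p + q)"
  define F' where "F' = (1 + y) * (1 + x * y) * q + (1 + x) * y * (p + q)"
  define s where "s = x * x * y + y + x * y * y + x + 4 * x * y"
  let ?N = "vector
      [vector [x * y * q * G * a, E * a, x * q * F * a, q * (x * y + s * a)],
       vector [y * q * E' * b, G * b, p * q * (x * y + s * b), F' * b],
       vector [x * y * p * F' * b, p * (x * y + s * b), x * y * p * G * b, y * E' * b],
       vector [y * p * q * (x * y + s * a), F * a, y * p * E * a, y * G * a]] :: 'a^4^4"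
  \<comment> \<open>The factors clear denominators; \<open>w\<close> on rows 2, 3 and
    \<open>w'\<close> on columns 2, 3 remove \<open>w\<close> from the matrix.\<close>
  let ?D = "diag4 (x * y * q^2 * p') (w * y * p^2) (w * x^2 * y * p^3) (x * y^2 * q * p')"
  let ?D' = "diag4 1 w' w' 1"
  have N: "?D ** ?M ** ?D' = ?N"
    unfolding diag4_scale coefP_def coefQ_def coefR_def coefS_def a_def b_def G_def E_def F_def
      E'_def F'_def s_def
    apply (intro vector_4_cong)
    subgoal by algebra
    subgoal using x y q w by algebra
    subgoal using y w by algebra
    subgoal using x y p q by algebra
    subgoal using x p q w by algebra
    subgoal using y p q w by algebra
    subgoal using x y p q w by algebra
    subgoal using y p q w by algebra
    subgoal using x y p q w by algebra
    subgoal using x y p q w by algebra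
    subgoal using x p q w by algebra
    subgoal using x y p w by algebra
    subgoal using x y p q by algebra
    subgoal using x y w by algebra
    subgoal using x y q w by algebra
    subgoal using x y by algebra
    done
  have r: "p * q * (a + b) - (p - q)^2 * a * b = 0"
    unfolding a_def b_def using p q hk by algebra
  \<comment> \<open>Both zeros multiplying or being squared stand for \<open>r\<close>;
    \<open>r[symmetric]\<close> expands them.\<close>
  have "det ?N = x^2 * y^3 * (p * q * (x * y * p * q + s * 0)^2 - x * y * G^2 * 0^2)"
    unfolding G_def E_def F_def E'_def F'_def s_def det_polynomial_form r[symmetric] ..
  also have "\<dots> = x^4 * y^5 * p^3 * q^3"
    by (simp add: power_mult_distrib eval_nat_numeral mult_ac)
  also have "det ?N = det ?D * det ?M * det ?D'"
    unfolding N[symmetric] det_mul ..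
  finally have DMD: "det ?D * det ?M * det ?D' = x^4 * y^5 * p^3 * q^3" .
  have DD: "det ?D * det ?D' = x^4 * y^5 * p^3 * q^3"
    unfolding det_diag4 using p w by algebra
  have "x \<noteq> 0" "y \<noteq> 0" "p \<noteq> 0" "q \<noteq> 0"
    using x y p q by auto
  then have m: "x^4 * y^5 * p^3 * q^3 \<noteq> 0"
    by simp
  have cancel: "M = 1" if "D * M * D' = m" "D * D' = m" "m \<noteq> 0" for D M D' m :: 'a
    using that by (metis mult.assoc mult.commute mult_cancel_left1)
  show ?thesis
    using DMD DD m by (rule cancel)
qed

section \<open>The relation in prime characteristic\<close>

lemma of_nat_CARD_eq_0: "of_nat CARD('a::ring_1) = (0 :: 'a)"
proof -
  \<comment> \<open>Translation by 1 permutes the ring. In the infinite case the sums and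
    \<open>CARD('a)\<close> are 0 by convention.\<close>
  have "(\<Sum>x::'a\<in>UNIV. x) + of_nat CARD('a) = (\<Sum>x\<in>UNIV. x + 1)"
    by (simp add: sum.distrib)
  also have "\<dots> = (\<Sum>x\<in>UNIV. x)"
    by (rule sum.reindex_bij_betw[OF bij_plus_right])
  finally show ?thesis
    unfolding add_cancel_left_right .
qed

lemma CHAR_poly_mapping: "CHAR('a::monoid_add \<Rightarrow>\<^sub>0 'b::semiring_1) = CHAR('b)"
proof -
  have "(of_nat n :: 'a \<Rightarrow>\<^sub>0 'b) = 0 \<longleftrightarrow> (of_nat n :: 'b) = 0" for n
    by (auto simp: poly_mapping_eq_iff fun_eq_iff lookup_of_nat when_def)
  then show ?thesis
    by (intro CHAR_eqI) (simp_all only: of_nat_CHAR of_nat_eq_0_iff_char_dvd dvd_refl)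
qed

text \<open>Since \<open>(1 - v)^2 * k\<close> equals \<open>1 - v ^ CHAR('a)\<close>, the right
  side is \<open>h - h * v ^ CHAR('a)\<close>, and \<open>h * v ^ (CHAR('a) - 2)\<close> equals
  \<open>- k\<close>.\<close>

lemma prime_char_power_relation:
  fixes v :: "'a::comm_ring_1"
  assumes "prime CHAR('a)" and v: "v * v' = 1"
    and h: "h = (1 - v') ^ (CHAR('a) - 2)" and k: "k = (1 - v) ^ (CHAR('a) - 2)"
  shows "h + v^2 * k = (1 - v)^2 * h * k"
proof -
  define n where "n = CHAR('a) - 2"
  have d: "CHAR('a) = n + 2"
    using prime_ge_2_nat[OF assms(1)] by (simp add: n_def)
  \<comment> \<open>This covers characteristic 2 as well, where \<open>n = 0\<close> and it reads
    \<open>1 = -1\<close>.\<close>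
  have sign: "(-1) ^ n = (-1 :: 'a)"
  proof -
    have "(1 + - 1 :: 'a) ^ CHAR('a) = 1 ^ CHAR('a) + (-1) ^ CHAR('a)"
      by (rule freshmans_dream) (simp_all add: assms(1))
    then have "(-1) ^ CHAR('a) = (-1 :: 'a)"
      by (simp add: d eq_neg_iff_add_eq_0 add.commute)
    then show ?thesis
      by (simp add: d power_add)
  qed
  have "(1 - v) ^ CHAR('a) + v ^ CHAR('a) = 1"
    using freshmans_dream[of "CHAR('a)" "1 - v" v] assms(1) by simp
  moreover have "(1 - v) ^ CHAR('a) = (1 - v)^2 * k"
    unfolding k d by (simp only: power_add diff_add_inverse2 mult.commute)
  ultimately have vd: "v ^ (n + 2) = 1 - (1 - v)^2 * k"
    by (simp only: d eq_diff_eq add.commute)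
  have "h * v ^ n = ((1 - v') * v) ^ n"
    by (simp add: h d power_mult_distrib)
  also have "(1 - v') * v = (-1) * (1 - v)"
    using v by (simp add: algebra_simps)
  also have "((-1) * (1 - v)) ^ n = - k"
    by (simp only: power_mult_distrib sign) (simp add: k d)
  finally have "(h * v ^ n) * v^2 = - k * v^2"
    by simp
  then have "h * v ^ (n + 2) = - (v^2 * k)"
    by (simp add: power_add algebra_simps power2_eq_square)
  then show ?thesis
    unfolding vd by (simp add: algebra_simps)
qed

theorem proposition1:
  fixes d :: nat and t w :: int
    and u :: "'k::field laurent3^4^4"
  assumes "prime d" and "CARD('k) = d"
    and "u = matU d t w"
  shows "invertible u \<and> det u = 1 \<and> det (matrix_inv u) = 1"
proof -
  have "CHAR('k) dvd d"
    using of_nat_CARD_eq_0[where 'a = 'k] assms by (simp add: of_nat_eq_0_iff_char_dvd)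
  moreover have "CHAR('k) \<noteq> 1"
    by simp
  ultimately have "CHAR('k) = d"
    using assms(1) by (auto simp: prime_nat_iff)
  then have char: "CHAR('k laurent3) = d"
    by (simp add: CHAR_poly_mapping)
  define h k :: "'k laurent3" where "h = (1 - xyz 0 0 (1 - 2 * t)) ^ (d - 2)"
    and "k = (1 - xyz 0 0 (2 * t - 1)) ^ (d - 2)"
  let ?v = "xyz 0 0 (2 * t - 1) :: 'k laurent3"
  let ?p = "xyz 0 0 t :: 'k laurent3" and ?q = "xyz 0 0 (1 - t) :: 'k laurent3"
  have "h + ?v^2 * k = (1 - ?v)^2 * h * k"
    by (rule prime_char_power_relation[where v' = "xyz 0 0 (1 - 2 * t)"])
      (simp_all add: char assms(1) h_def k_def xyz_mult xyz_0)
  moreover have "?v * ?q = ?p"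
    by (simp add: xyz_mult)
  \<comment> \<open>The relation multiplied by \<open>?q^2\<close>, with \<open>?v * ?q\<close>
    replaced by \<open>?p\<close>.\<close>
  ultimately have hk: "?q^2 * h + ?p^2 * k = (?p - ?q)^2 * h * k"
    by algebra
  let ?x = "xyz 1 0 0 :: 'k laurent3" and ?x' = "xyz (-1) 0 0 :: 'k laurent3"
  let ?y = "xyz 0 1 0 :: 'k laurent3" and ?y' = "xyz 0 (-1) 0 :: 'k laurent3"
  let ?p' = "xyz 0 0 (-t) :: 'k laurent3" and ?q' = "xyz 0 0 (t - 1) :: 'k laurent3"
  let ?w = "xyz 0 0 w :: 'k laurent3" and ?w' = "xyz 0 0 (-w) :: 'k laurent3"
  \<comment> \<open>Exponents of \<open>z\<close> in \<open>p * q'\<close>, \<open>p' * q\<close>,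
    \<open>p' * q'\<close> and \<open>p * q\<close>.\<close>
  have exponents: "t + (t - 1) = 2 * t - 1" "- t + (1 - t) = 1 - 2 * t" "t - 1 + - t = - 1"
    "t + (1 - t) = 1"
    by simp_all
  have u_eq: "u = vector
      [vector [coefP ?x ?y ?p ?q h, coefQ ?w ?x ?x' ?y' (?p * ?q') h, coefR ?w ?x ?y ?y' ?p ?q h,
         coefS ?x ?x' ?y ?y' (?p * ?q') h],
       vector [?x * coefQ ?w' ?x ?x' ?y (?p' * ?q) k, coefP ?x ?y' ?p' ?q' k,
         ?x * coefS ?x ?x' ?y' ?y (?p' * ?q) k, coefR ?w' ?x ?y' ?y ?p' ?q' k],
       vector [?y * coefR ?w' ?x' ?y ?y' ?p' ?q' k,
         ?x' * ?p' * ?q' * coefS ?x' ?x ?y ?y' (?p' * ?q) k, coefP ?x' ?y ?p' ?q' k,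
         ?x' * ?y * ?p' * ?q' * coefQ ?w' ?x' ?x ?y' (?p' * ?q) k],
       vector [?p * ?q * coefS ?x' ?x ?y' ?y (?p * ?q') h, ?y' * coefR ?w ?x' ?y' ?y ?p ?q h,
         ?y' * ?p * ?q * coefQ ?w ?x' ?x ?y (?p * ?q') h, coefP ?x' ?y' ?p ?q h]]"
    unfolding assms(3) matU_def matP_def matQ_def matR_def matS_def matrix_inv_matX matrix_inv_matY
      mat_powi_matZ matH_eq h_def[symmetric] k_def[symmetric]
    unfolding matX_eq matY_eq mat_eq_diag4
      diag4_mult diag4_add diag4_combination coefP_def coefQ_def coefR_def coefS_def
    by (intro vector_4_cong)
      (simp_all only: xyz_mult add_0_left add_0_right minus_diff_eq mult_1 exponents mult_ac)
  have "det u = 1"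
    unfolding u_eq
    by (rule det_unit_form[where x = ?x and x' = ?x' and y = ?y and y' = ?y' and p = ?p and p' = ?p'
          and q = ?q and q' = ?q' and w = ?w and w' = ?w' and h = h and k = k, OF _ _ _ _ _ hk])
      (simp_all add: xyz_mult xyz_0)
  then show ?thesis
    by (intro conjI invertible_if_det_eq_1 det_matrix_inv_if_det_eq_1)
qed

end
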